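(* Let $k\geq 1$ be an integer. Every finite triangle-free simple graph $G$ with at least one vertex and average degree at least $2k$ (i.e. $2e(G)/v(G)\geq 2k$) has a $(k+1)$-connected subgraph, and such a subgraph has at least $2(k+1)$ vertices.
   Context: $v(G)$ and $e(G)$ denote the numbers of vertices and edges of $G$. A graph is $(k+1)$-connected if it has more than $k+1$ vertices and remains connected after deleting any set of at most $k$ vertices. *)

theory Defs
  imports Complex_Main "Graph_Theory.Digraph_Component"
begin

text \<open>
  Finite simple graphs are given by the locale \<^locale>\<open>graph\<close>: finite symmetric digraphs without
  loops and parallel arcs. An undirected edge corresponds to a pair of opposite arcs, so edges
  are counted as unordered pairs of end vertices. A digraph subgraph need not be symmetric; hence
  a subgraph in the undirected sense is a \<^const>\<open>subgraph\<close> that is itself a \<^locale>\<open>graph\<close>.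
\<close>

definition edges :: "('a, 'b) pre_digraph \<Rightarrow> 'a set set" where
  "edges G = (\<lambda>a. {tail G a, head G a}) ` arcs G"

definition average_degree :: "('a, 'b) pre_digraph \<Rightarrow> real" where
  "average_degree G = 2 * real (card (edges G)) / real (card (verts G))"

text \<open>
  In a loop-free symmetric digraph, the three vertices below are automatically distinct.
\<close>

definition triangle_free :: "('a, 'b) pre_digraph \<Rightarrow> bool" where
  "triangle_free G \<longleftrightarrow>
    \<not> (\<exists>u v w. u \<rightarrow>\<^bsub>G\<^esub> v \<and> v \<rightarrow>\<^bsub>G\<^esub> w \<and> w \<rightarrow>\<^bsub>G\<^esub> u)"

text \<open>
  The constant \<open>connected\<close> is qualified because the topological notion has the same base name.
\<close>

definition vertex_connected :: "nat \<Rightarrow> ('a, 'b) pre_digraph \<Rightarrow> bool" where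
  "vertex_connected n G \<longleftrightarrow>
    card (verts G) > n \<and>
    (\<forall>S \<subseteq> verts G. card S < n \<longrightarrow>
      Digraph_Component.connected (G \<restriction> (verts G - S)))"

end

theory Submission
  imports Defs
begin

text \<open>
  The induction runs on the inequality \<open>e(G) > k (v(G) - k)\<close>, for triangle-free graphs with at least
  \<open>2k\<close> vertices. With exactly \<open>2k\<close> vertices it contradicts Mantel's theorem, and it survives the
  deletion of a vertex of degree at most \<open>k\<close>. If all degrees exceed \<open>k\<close> and a set \<open>S\<close> of at most
  \<open>k\<close> vertices separates \<open>G\<close>, then each of the two sides (taken together with \<open>S\<close>) contains two
  adjacent vertices of degree at least \<open>k + 1\<close> whose neighbourhoods are disjoint, hence
  at least \<open>2k + 2\<close> vertices; and the inequality passes to one of the sides, since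
  \<open>v\<^sub>1 + v\<^sub>2 = v(G) + |S| \<le> v(G) + k\<close> and \<open>e\<^sub>1 + e\<^sub>2 \<ge> e(G)\<close>. Only induced subgraphs occur, so the
  argument is about vertex sets. Edges are counted as ordered pairs, that is, twice.
\<close>

text \<open>Connectedness is encoded by cuts: every nonempty proper part \<open>A\<close> of
  \<open>X - S\<close> has an edge leaving it. An empty \<open>X - S\<close> would satisfy this
  vacuously, but \<open>card S < n < card X\<close> rules that out.\<close>

definition vertex_connected_on :: "('a \<times> 'a) set \<Rightarrow> nat \<Rightarrow> 'a set \<Rightarrow> bool" where
  "vertex_connected_on E n X \<longleftrightarrow>
    n < card X \<and>
    (\<forall>S\<subseteq>X. card S < n \<longrightarrow>
      (\<forall>A. A \<noteq> {} \<and> A \<subset> X - S \<longrightarrow> (\<exists>a\<in>A. \<exists>b\<in>X - S - A. (a, b) \<in> E)))"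

section \<open>Counting in triangle-free relations\<close>

locale triangle_free_relation =
  fixes E :: "('a \<times> 'a) set"
  assumes sym_E: "(u, v) \<in> E \<Longrightarrow> (v, u) \<in> E"
    and no_triangle: "(u, v) \<in> E \<Longrightarrow> (v, w) \<in> E \<Longrightarrow> (w, u) \<notin> E"
begin

text \<open>A loop at \<open>u\<close> would be a degenerate triangle with all three vertices equal
  to \<open>u\<close>.\<close>

lemma irrefl_E: "(u, u) \<notin> E"
  using no_triangle by blast

lemma adjacent_imp_disjoint_nbrs: "(u, v) \<in> E \<Longrightarrow> E `` {u} \<inter> E `` {v} = {}"
  using no_triangle sym_E by blast

lemma adjacent_degrees_le_card:
  assumes "finite X" "(u, v) \<in> E" "d \<le> card (E `` {u} \<inter> X)" "d \<le> card (E `` {v} \<inter> X)"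
  shows "2 * d \<le> card X"
proof -
  have "card (E `` {u} \<inter> X) + card (E `` {v} \<inter> X) = card ((E `` {u} \<inter> X) \<union> (E `` {v} \<inter> X))"
    using adjacent_imp_disjoint_nbrs[OF assms(2)] assms(1)
    by (intro card_Un_disjoint[symmetric]) auto
  also have "\<dots> \<le> card X"
    using assms(1) by (intro card_mono) auto
  finally show ?thesis
    using assms(3,4) by linarith
qed

lemma card_edges_delete_vertex:
  assumes "finite X"
  shows "card (E \<inter> X \<times> X) \<le> card (E \<inter> (X - {u}) \<times> (X - {u})) + 2 * card (E `` {u} \<inter> X)"
proof -
  let ?N = "E `` {u} \<inter> X"
  have "E \<inter> X \<times> X \<subseteq> E \<inter> (X - {u}) \<times> (X - {u}) \<union> ({u} \<times> ?N \<union> ?N \<times> {u})"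
    using sym_E by auto
  then have "card (E \<inter> X \<times> X) \<le> card (E \<inter> (X - {u}) \<times> (X - {u}) \<union> ({u} \<times> ?N \<union> ?N \<times> {u}))"
    using assms by (intro card_mono) auto
  also have "\<dots> \<le> card (E \<inter> (X - {u}) \<times> (X - {u})) + card ({u} \<times> ?N \<union> ?N \<times> {u})"
    by (rule card_Un_le)
  also have "card ({u} \<times> ?N \<union> ?N \<times> {u}) \<le> card ({u} \<times> ?N) + card (?N \<times> {u})"
    by (rule card_Un_le)
  finally show ?thesis
    by (simp add: card_cartesian_product)
qed

text \<open>Since ordered pairs count each edge twice, this is the usual bound n^2/4 on the number
  of edges. For \<open>u\<close> of maximum degree, each edge meets the set \<open>D\<close> of
  non-neighbours of \<open>u\<close>, so the degree sum over \<open>D\<close>, at most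
  \<open>deg u * card D\<close>, bounds the number of edges.\<close>

lemma mantel:
  assumes "finite X"
  shows "2 * card (E \<inter> X \<times> X) \<le> (card X)\<^sup>2"
proof (cases "X = {}")
  case False
  define deg where "deg v = card (E `` {v} \<inter> X)" for v
  obtain u where u: "u \<in> X" "\<And>v. v \<in> X \<Longrightarrow> deg v \<le> deg u"
    using Max_in[of "deg ` X"] Max_ge[of "deg ` X"] assms False
    by (metis (no_types, lifting) finite_imageI image_iff image_is_empty)
  define D where "D = X - E `` {u}"
  define C where "C = (SIGMA x:D. E `` {x} \<inter> X)"
  have card_X: "card X = deg u + card D"
    using card_Int_Diff[OF assms, of "E `` {u}"] by (simp only: deg_def D_def Int_commute)
  have fin: "finite C"
    using assms unfolding C_def D_def by (intro finite_SigmaI) simp_all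
  \<comment> \<open>The neighbourhood of \<open>u\<close> is independent, so every edge has an end in its complement \<open>D\<close>.\<close>
  have "E \<inter> X \<times> X \<subseteq> C \<union> C\<inverse>"
  proof (rule subrelI)
    fix x y assume xy: "(x, y) \<in> E \<inter> X \<times> X"
    then have "x \<in> D \<or> y \<in> D"
      using no_triangle[of u x y] sym_E[of u y] by (auto simp: D_def)
    then show "(x, y) \<in> C \<union> C\<inverse>"
      using xy sym_E[of x y] by (auto simp: C_def)
  qed
  then have "card (E \<inter> X \<times> X) \<le> card (C \<union> C\<inverse>)"
    using fin by (intro card_mono) auto
  also have "\<dots> \<le> card C + card (C\<inverse>)"
    by (rule card_Un_le)
  also have "\<dots> = 2 * card C"
    by simp
  also have "card C = (\<Sum>x\<in>D. deg x)"
    unfolding C_def deg_def using assms by (intro card_SigmaI) (auto simp: D_def)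
  also have "\<dots> \<le> card D * deg u"
    using sum_bounded_above[of D deg "deg u"] u(2) by (auto simp: D_def)
  finally have "2 * card (E \<inter> X \<times> X) \<le> 4 * deg u * card D"
    by (simp add: mult.commute)
  \<comment> \<open>The inequality 4ab \<le> (a + b)^2, from (a - b)^2 \<ge> 0 over the integers,
    where subtraction does not truncate.\<close>
  also have "\<dots> \<le> (deg u + card D)\<^sup>2"
    using zero_le_power2[of "int (deg u) - int (card D)"]
    by (simp add: power2_eq_square algebra_simps flip: of_nat_le_iff[where 'a = int])
  finally show ?thesis
    by (simp add: card_X)
qed simp

section \<open>Degrees, connectivity and separators\<close>

lemma vertex_connected_on_degree:
  assumes "finite X" "vertex_connected_on E n X" "u \<in> X"
  shows "n \<le> card (E `` {u} \<inter> X)"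
proof (rule ccontr)
  \<comment> \<open>Deleting the neighbours of \<open>u\<close> isolates \<open>u\<close>; if there
    were fewer than \<open>n\<close> of them, this would be a forbidden separator.\<close>
  let ?S = "E `` {u} \<inter> X"
  assume "\<not> n \<le> card ?S"
  then have less: "card ?S < n"
    by simp
  have "card (X - ?S) = card X - card ?S"
    using assms(1) by (intro card_Diff_subset) auto
  \<comment> \<open>At least \<open>n + 1\<close> vertices minus at most \<open>n - 1\<close> leave
    two or more, so \<open>{u}\<close> is a proper part of the rest.\<close>
  then have "card (X - ?S) \<noteq> card {u}"
    using less assms(2) by (auto simp: vertex_connected_on_def)
  then have "{u} \<subset> X - ?S"
    using assms(3) irrefl_E by auto
  then have "\<exists>a\<in>{u}. \<exists>b\<in>X - ?S - {u}. (a, b) \<in> E"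
    using assms(2) less unfolding vertex_connected_on_def by blast
  then show False
    by auto
qed

text \<open>Every degree is at least \<open>n > 0\<close>, so some edge exists, and its two ends
  have disjoint neighbourhoods.\<close>

lemma card_ge_if_vertex_connected_on:
  assumes "finite X" "vertex_connected_on E n X" "0 < n"
  shows "2 * n \<le> card X"
proof -
  obtain u where u: "u \<in> X"
    using assms(2) by (fastforce simp: vertex_connected_on_def)
  have "E `` {u} \<inter> X \<noteq> {}"
    using vertex_connected_on_degree[OF assms(1,2) u] assms(3) by auto
  then obtain v where "v \<in> X" "(u, v) \<in> E"
    by auto
  then show ?thesis
    using adjacent_degrees_le_card vertex_connected_on_degree assms(1,2) u by blast
qed

text \<open>Vertices of \<open>A\<close> keep all their neighbours inside
  \<open>A \<union> S\<close>, whereas those of \<open>S\<close> may lose some. The adjacent pair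
  must therefore lie in \<open>A\<close>.\<close>

lemma card_side_of_separator:
  assumes "finite X" "S \<subseteq> X" "card S \<le> k" "A \<subseteq> X - S" "A \<noteq> {}"
    and deg: "\<And>v. v \<in> X \<Longrightarrow> k < card (E `` {v} \<inter> X)"
    and sep: "\<And>a b. a \<in> A \<Longrightarrow> b \<in> X - S - A \<Longrightarrow> (a, b) \<notin> E"
  shows "2 * (k + 1) \<le> card (A \<union> S)"
proof -
  have fin: "finite (A \<union> S)"
    using assms(1,2,4) by (meson Diff_subset Un_least finite_subset subset_trans)
  have deg': "k + 1 \<le> card (E `` {v} \<inter> (A \<union> S))" if "v \<in> A" for v
  proof -
    have "E `` {v} \<inter> X = E `` {v} \<inter> (A \<union> S)"
      using sep[OF that] assms(2,4) by auto
    then show ?thesis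
      using deg[of v] that assms(4) by auto
  qed
  obtain u where u: "u \<in> A"
    using assms(5) by auto
  \<comment> \<open>More than \<open>k\<close> neighbours cannot all fit into \<open>S\<close>, so
    \<open>u\<close> has a neighbour in \<open>A\<close>.\<close>
  have "\<not> E `` {u} \<inter> (A \<union> S) \<subseteq> S"
    using card_mono[of S "E `` {u} \<inter> (A \<union> S)"] fin deg'[OF u] assms(3) by auto
  then obtain v where "v \<in> A" "(u, v) \<in> E"
    by auto
  then show ?thesis
    using adjacent_degrees_le_card[OF fin] deg' u by blast
qed

text \<open>The last assumption is e > k (v - k), doubled for ordered pairs and rearranged to avoid
  subtraction on naturals.\<close>

theorem ex_vertex_connected_on:
  assumes "0 < k" "finite X" "2 * k \<le> card X"
    and "2 * k * card X < card (E \<inter> X \<times> X) + 2 * k * k"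
  shows "\<exists>Y\<subseteq>X. vertex_connected_on E (k + 1) Y"
  using assms(2-)
proof (induction "card X" arbitrary: X rule: less_induct)
  case less
  let ?e = "\<lambda>X. card (E \<inter> X \<times> X)"
  \<comment> \<open>With \<open>2 * k\<close> vertices the assumption would give more than
    \<open>2 * k * k\<close> ordered pairs, exactly Mantel's bound.\<close>
  have "card X \<noteq> 2 * k"
    using mantel[of X] less.prems by (auto simp: power2_eq_square)
  then have card_X: "2 * k < card X"
    using less.prems(2) by simp
  show ?case
  proof (cases "\<exists>u\<in>X. card (E `` {u} \<inter> X) \<le> k")
    case True
    then obtain u where u: "u \<in> X" "card (E `` {u} \<inter> X) \<le> k"
      by blast
    let ?X' = "X - {u}"
    have card': "card X = Suc (card ?X')"
      using less.prems(1) u(1) by (rule card.remove)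
    have "?e X \<le> ?e ?X' + 2 * k"
      using card_edges_delete_vertex[OF less.prems(1), of u] u(2) by linarith
    \<comment> \<open>The left side drops by exactly \<open>2 * k\<close>, the pair count by at most
      that much.\<close>
    then have "2 * k * card ?X' < ?e ?X' + 2 * k * k"
      using less.prems(3) by (simp add: card')
    moreover have "2 * k \<le> card ?X'"
      using card_X card' by simp
    ultimately have "\<exists>Y\<subseteq>?X'. vertex_connected_on E (k + 1) Y"
      using less.prems(1) card' by (intro less.hyps) simp_all
    then show ?thesis
      by (meson Diff_subset subset_trans)
  next
    case False
    then have deg: "k < card (E `` {u} \<inter> X)" if "u \<in> X" for u
      using that by force
    show ?thesis
    proof (cases "vertex_connected_on E (k + 1) X")
      case False
      have "k + 1 < card X"
        using card_X assms(1) by linarith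
      then obtain S A where S: "S \<subseteq> X" "card S < k + 1" and A: "A \<noteq> {}" "A \<subset> X - S"
        and no_edge: "\<not> (\<exists>a\<in>A. \<exists>b\<in>X - S - A. (a, b) \<in> E)"
        using False unfolding vertex_connected_on_def by meson
      have sep: "(a, b) \<notin> E" if "a \<in> A" "b \<in> X - S - A" for a b
        using no_edge that by blast
      have card_S: "card S \<le> k"
        using S(2) by simp
      let ?B = "X - S - A"
      have fin: "finite S" "finite A" "finite ?B"
        using S(1) A(2) less.prems(1) by (auto intro: finite_subset)
      have sides: "2 * (k + 1) \<le> card (A \<union> S)" "2 * (k + 1) \<le> card (?B \<union> S)"
      proof -
        show "2 * (k + 1) \<le> card (A \<union> S)"
          using less.prems(1) S(1) card_S A deg sep by (intro card_side_of_separator[of X]) auto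
        \<comment> \<open>The roles of the sides are exchanged: \<open>X - S - ?B\<close> is
          \<open>A\<close>, and \<open>E\<close> is symmetric.\<close>
        have "(b, a) \<notin> E" if "b \<in> ?B" "a \<in> X - S - ?B" for a b
          using sep[of a b] sym_E that by blast
        then show "2 * (k + 1) \<le> card (?B \<union> S)"
          using less.prems(1) S(1) card_S A(2) deg by (intro card_side_of_separator[of X]) auto
      qed
      have cards: "card (A \<union> S) = card A + card S" "card (?B \<union> S) = card ?B + card S"
        using fin A(2) by (auto intro!: card_Un_disjoint)
      have "card X = card (A \<union> ?B \<union> S)"
        using A(2) S(1) by (intro arg_cong[of _ _ card]) auto
      also have "\<dots> = card (A \<union> ?B) + card S"
        by (rule card_Un_disjoint) (use fin A(2) in auto)
      also have "card (A \<union> ?B) = card A + card ?B"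
        by (rule card_Un_disjoint) (use fin in auto)
      finally have card_parts: "card X = card A + card ?B + card S" .
      have "card A > 0" "card ?B > 0"
        using A fin by (auto simp: card_gt_0_iff)
      then have smaller: "card (A \<union> S) < card X" "card (?B \<union> S) < card X"
        using cards card_parts by auto
      have "E \<inter> X \<times> X \<subseteq> E \<inter> (A \<union> S) \<times> (A \<union> S) \<union> E \<inter> (?B \<union> S) \<times> (?B \<union> S)"
        using sep sym_E by blast
      then have "?e X \<le> card (E \<inter> (A \<union> S) \<times> (A \<union> S) \<union> E \<inter> (?B \<union> S) \<times> (?B \<union> S))"
        using fin by (intro card_mono) auto
      also have "\<dots> \<le> ?e (A \<union> S) + ?e (?B \<union> S)"
        by (rule card_Un_le)
      finally have edges: "?e X \<le> ?e (A \<union> S) + ?e (?B \<union> S)" .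
      have "2 * k * card (A \<union> S) < ?e (A \<union> S) + 2 * k * k \<or>
          2 * k * card (?B \<union> S) < ?e (?B \<union> S) + 2 * k * k"
      proof (rule ccontr)
        assume "\<not> ?thesis"
        \<comment> \<open>Sum of the two negated inequalities; \<open>S\<close> is counted in both
          sides, which costs only \<open>2 * k * card S \<le> 2 * k * k\<close>.\<close>
        then have "?e X + 4 * k * k \<le> 2 * k * (card (A \<union> S) + card (?B \<union> S))"
          using edges by (simp add: algebra_simps)
        also have "\<dots> = 2 * k * card X + 2 * k * card S"
          by (simp add: cards card_parts algebra_simps)
        also have "\<dots> \<le> 2 * k * card X + 2 * k * k"
          using card_S by simp
        finally show False
          using less.prems(3) by simp
      qed
      then obtain Z where "Z \<in> {A \<union> S, ?B \<union> S}" "2 * k * card Z < ?e Z + 2 * k * k"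
        by blast
      then have "card Z < card X" "finite Z" "2 * k \<le> card Z" "Z \<subseteq> X"
          "2 * k * card Z < ?e Z + 2 * k * k"
        using smaller sides fin S(1) A(2) by auto
      then show ?thesis
        using less.hyps[of Z] by (meson subset_trans)
    qed blast
  qed
qed

end

section \<open>Transfer to symmetric digraphs\<close>

lemma connected_iff_crossing:
  assumes "Digraph.graph H"
  shows "Digraph_Component.connected H \<longleftrightarrow> verts H \<noteq> {} \<and>
    (\<forall>A. A \<noteq> {} \<and> A \<subset> verts H \<longrightarrow> (\<exists>a\<in>A. \<exists>b\<in>verts H - A. a \<rightarrow>\<^bsub>H\<^esub> b))"
    (is "?L \<longleftrightarrow> ?R")
proof
  interpret graph H by fact
  assume ?L
  then have sc: "strongly_connected H"
    using symmetric_connected_imp_strongly_connected sym_arcs by blast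
  show ?R
  proof (intro conjI allI impI)
    show "verts H \<noteq> {}"
      using sc by (simp add: strongly_connected_def)
    fix A assume A: "A \<noteq> {} \<and> A \<subset> verts H"
    then obtain a c where ac: "a \<in> A" "a \<in> verts H" "c \<in> verts H" "c \<notin> A"
      by blast
    then have "a \<rightarrow>\<^sup>*\<^bsub>H\<^esub> c"
      using sc by auto
    \<comment> \<open>Along a walk from \<open>A\<close> to a vertex outside, some arc is the first
      to leave \<open>A\<close>.\<close>
    then show "\<exists>a\<in>A. \<exists>b\<in>verts H - A. a \<rightarrow>\<^bsub>H\<^esub> b"
      using ac(1,4)
    proof (induction rule: converse_reachable_induct)
      case (step x y)
      then show ?case
        using adj_in_verts(2) by blast
    qed simp
  qed
next
  interpret graph H by fact
  assume R: ?R
  have "u \<rightarrow>\<^sup>*\<^bsub>H\<^esub> v" if "u \<in> verts H" "v \<in> verts H" for u v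
  proof (rule ccontr)
    assume not: "\<not> u \<rightarrow>\<^sup>*\<^bsub>H\<^esub> v"
    \<comment> \<open>No arc can leave the set of vertices reachable from \<open>u\<close>, so it
      violates the cut condition if it misses \<open>v\<close>.\<close>
    let ?A = "{w. u \<rightarrow>\<^sup>*\<^bsub>H\<^esub> w}"
    have "?A \<noteq> {}" "?A \<subset> verts H"
      using that not reachable_in_verts(2) by auto
    then have "\<exists>a\<in>?A. \<exists>b\<in>verts H - ?A. a \<rightarrow>\<^bsub>H\<^esub> b"
      by (intro R[THEN conjunct2, rule_format] conjI)
    then obtain a b where "u \<rightarrow>\<^sup>*\<^bsub>H\<^esub> a" "a \<rightarrow>\<^bsub>H\<^esub> b" "\<not> u \<rightarrow>\<^sup>*\<^bsub>H\<^esub> b"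
      by auto
    then show False
      using reachable_adj_trans by blast
  qed
  then have "strongly_connected H"
    using R by (auto simp: strongly_connected_def)
  then show ?L
    by (auto simp: connected_def strongly_connected_def intro: reachable_mk_symmetricI)
qed

lemma arcs_ends_induce_subgraph:
  "arcs_ends (G \<restriction> X) = arcs_ends G \<inter> X \<times> X"
  by (auto simp: arcs_ends_conv)

lemma graph_induce_subgraph:
  assumes "Digraph.graph G" "X \<subseteq> verts G"
  shows "Digraph.graph (G \<restriction> X)"
proof -
  interpret graph G by fact
  have ind: "induced_subgraph (G \<restriction> X) G"
    using assms(2) by (rule induced_induce)
  interpret X: digraph "G \<restriction> X"
    using ind by (rule digraphI_induced)
  interpret X: sym_digraph "G \<restriction> X"
    using ind by (rule induced_graph_imp_graph)
  show ?thesis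
    by unfold_locales
qed

lemma vertex_connected_iff:
  assumes "Digraph.graph H"
  shows "vertex_connected n H \<longleftrightarrow> vertex_connected_on (arcs_ends H) n (verts H)"
proof -
  interpret graph H by fact
  have "Digraph_Component.connected (H \<restriction> (verts H - S)) \<longleftrightarrow>
      (\<forall>A. A \<noteq> {} \<and> A \<subset> verts H - S \<longrightarrow> (\<exists>a\<in>A. \<exists>b\<in>verts H - S - A. a \<rightarrow>\<^bsub>H\<^esub> b))"
    if "n < card (verts H)" "S \<subseteq> verts H" "card S < n" for S
  proof -
    have "verts H - S \<noteq> {}"
      using that by auto
    moreover have "Digraph.graph (H \<restriction> (verts H - S))"
      using graph_induce_subgraph[OF assms] by blast
    ultimately show ?thesis
      by (subst connected_iff_crossing) (auto simp: arcs_ends_induce_subgraph; blast)+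
  qed
  then show ?thesis
    by (cases "n < card (verts H)") (simp_all add: vertex_connected_def vertex_connected_on_def)
qed

lemma vertex_connected_on_Int:
  "vertex_connected_on (E \<inter> X \<times> X) n X \<longleftrightarrow> vertex_connected_on E n X"
proof -
  have "(\<exists>a\<in>A. \<exists>b\<in>X - S - A. (a, b) \<in> E \<inter> X \<times> X) \<longleftrightarrow> (\<exists>a\<in>A. \<exists>b\<in>X - S - A. (a, b) \<in> E)"
    if "A \<subset> X - S" for A S
    using that by blast
  then show ?thesis
    unfolding vertex_connected_on_def by meson
qed

lemma triangle_free_relation_arcs_ends:
  assumes "Digraph.graph G" "triangle_free G"
  shows "triangle_free_relation (arcs_ends G)"
proof -
  interpret graph G by fact
  show ?thesis
  proof
    show "v \<rightarrow>\<^bsub>G\<^esub> u" if "u \<rightarrow>\<^bsub>G\<^esub> v" for u v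
      using arcs_ends_symmetric[OF sym_arcs that] .
    show "\<not> w \<rightarrow>\<^bsub>G\<^esub> u" if "u \<rightarrow>\<^bsub>G\<^esub> v" "v \<rightarrow>\<^bsub>G\<^esub> w" for u v w
      using assms(2) that unfolding triangle_free_def by blast
  qed
qed

lemma triangle_free_subgraph:
  assumes "subgraph H G" "triangle_free G"
  shows "triangle_free H"
  using assms arcs_ends_mono unfolding triangle_free_def by blast

text \<open>Double counting: the fibre of \<open>(u, v) \<mapsto> {u, v}\<close> over an edge
  contains both orientations, which differ as there are no loops.\<close>

lemma twice_card_edges_le:
  assumes "Digraph.graph G"
  shows "2 * card (edges G) \<le> card (arcs_ends G)"
proof -
  interpret graph G by fact
  let ?E = "arcs_ends G" and ?f = "\<lambda>p. {fst p, snd p}"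
  have fin: "finite ?E"
    by (simp add: arcs_ends_conv)
  have fibre: "2 \<le> card {p \<in> ?E. ?f p = e}" if e: "e \<in> ?f ` ?E" for e
  proof -
    obtain u v where uv: "(u, v) \<in> ?E" "e = {u, v}"
      using e by (metis (lifting) imageE prod.collapse)
    then have "(v, u) \<in> ?E" "u \<noteq> v"
      using adj_not_same arcs_ends_symmetric[OF sym_arcs] by auto
    then have "card {(u, v), (v, u)} = 2" "{(u, v), (v, u)} \<subseteq> {p \<in> ?E. ?f p = e}"
      using uv by auto
    then show ?thesis
      using card_mono[of "{p \<in> ?E. ?f p = e}" "{(u, v), (v, u)}"] fin by simp
  qed
  have "edges G = ?f ` ?E"
    by (auto simp: edges_def arcs_ends_conv image_image)
  then have "2 * card (edges G) \<le> (\<Sum>e\<in>?f ` ?E. card {p \<in> ?E. ?f p = e})"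
    using sum_bounded_below[of "?f ` ?E" 2 "\<lambda>e. card {p \<in> ?E. ?f p = e}"] fibre
    by (simp add: mult.commute)
  also have "\<dots> = card ?E"
    using sum.image_gen[OF fin, of "\<lambda>_. 1::nat" ?f] by simp
  finally show ?thesis .
qed

theorem theorem3:
  fixes G :: "('a, 'b) pre_digraph" and k :: nat
  assumes "k \<ge> 1"
    and "Digraph.graph G"
    and "verts G \<noteq> {}"
    and "triangle_free G"
    and "average_degree G \<ge> 2 * real k"
  shows "(\<exists>H. subgraph H G \<and> Digraph.graph H \<and> vertex_connected (k + 1) H) \<and>
    (\<forall>H. subgraph H G \<and> Digraph.graph H \<and> vertex_connected (k + 1) H \<longrightarrow>
      card (verts H) \<ge> 2 * (k + 1))"
proof (intro conjI allI impI)
  interpret graph G by fact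
  interpret triangle_free_relation "arcs_ends G"
    using triangle_free_relation_arcs_ends assms(2,4) by blast
  let ?V = "verts G"
  have card_pos: "0 < card ?V"
    using assms(3) by (simp add: card_gt_0_iff)
  have ends: "arcs_ends G \<inter> ?V \<times> ?V = arcs_ends G"
    using adj_in_verts by auto
  have "real k * real (card ?V) \<le> real (card (edges G))"
    using assms(5) card_pos by (simp add: average_degree_def field_simps)
  then have "k * card ?V \<le> card (edges G)"
    by (metis of_nat_le_iff of_nat_mult)
  then have edges: "2 * k * card ?V \<le> card (arcs_ends G)"
    using twice_card_edges_le[OF assms(2)] by linarith
  \<comment> \<open>Mantel's theorem turns the edge bound into a bound on the order: cancelling
    \<open>card ?V\<close> yields even \<open>4 * k \<le> card ?V\<close>.\<close>
  have "2 * (2 * k * card ?V) \<le> (card ?V)\<^sup>2"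
    using mantel[of ?V] edges ends by simp
  then have "2 * k \<le> card ?V"
    using card_pos by (simp add: power2_eq_square)
  \<comment> \<open>Strictness comes from the positive term \<open>2 * k * k\<close>, as
    \<open>k \<ge> 1\<close>.\<close>
  moreover have "2 * k * card ?V < card (arcs_ends G \<inter> ?V \<times> ?V) + 2 * k * k"
    using add_le_less_mono[OF edges, of 0 "2 * k * k"] assms(1) by (simp add: ends)
  ultimately obtain Y where Y: "Y \<subseteq> ?V" "vertex_connected_on (arcs_ends G) (k + 1) Y"
    using ex_vertex_connected_on[of k ?V] assms(1) by auto
  have graph: "Digraph.graph (G \<restriction> Y)"
    using graph_induce_subgraph assms(2) Y(1) by blast
  moreover have "vertex_connected (k + 1) (G \<restriction> Y)"
    using Y(2) vertex_connected_iff[OF graph]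
    by (simp add: arcs_ends_induce_subgraph vertex_connected_on_Int)
  moreover have "subgraph (G \<restriction> Y) G"
    using induced_induce[OF Y(1)] induced_imp_subgraph by blast
  ultimately show "\<exists>H. subgraph H G \<and> Digraph.graph H \<and> vertex_connected (k + 1) H"
    by blast
next
  fix H assume H: "subgraph H G \<and> Digraph.graph H \<and> vertex_connected (k + 1) H"
  then interpret H: graph H
    by blast
  interpret triangle_free_relation "arcs_ends H"
    using H assms(4) triangle_free_subgraph triangle_free_relation_arcs_ends by blast
  have "vertex_connected_on (arcs_ends H) (k + 1) (verts H)"
    using H vertex_connected_iff[of H "k + 1"] by simp
  then show "2 * (k + 1) \<le> card (verts H)"
    by (intro card_ge_if_vertex_connected_on H.finite_verts) simp_all
qed

end
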